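(* Let $G=UT_3(\mathbb{F}_3)$ be the group of upper unitriangular $3\times 3$ matrices over $\mathbb{F}_3$, with elements $$g(a,b,c)=\begin{pmatrix}1&a&b\\0&1&c\\0&0&1\end{pmatrix},\qquad a,b,c\in\mathbb{F}_3,$$ and let $\omega=e^{2\pi i/3}$. Up to isomorphism $G$ has exactly $11$ irreducible complex representations, namely the following pairwise non-isomorphic ones. (a) Nine one-dimensional representations $\rho_{r,s}$, $(r,s)\in\mathbb{F}_3^2$, given by $$\rho_{r,s}(g(a,b,c))=\omega^{ra+sc}.$$ (b) Two three-dimensional representations $\rho_k=\mathrm{Ind}_H^G(\tau_k)$, $k\in\{1,2\}$, where $H=\{g(0,b,c):b,c\in\mathbb{F}_3\}$ and $\tau_k:H\to\mathbb{C}^*$ is the character $\tau_k(g(0,b,c))=\omega^{kb}$. An element $\phi$ of the representation space of $\rho_k$ is uniquely determined by its values at $g(0,0,0),g(1,0,0),g(2,0,0)$, and $\rho_k$ is given explicitly by $$(\rho_k(g(a,b,c))\phi)(g(n,0,0))=\omega^{k(b+nc)}\,\phi(g(a+n,0,0)),\qquad n\in\mathbb{F}_3.$$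
   Context: For a subgroup $H\le G$ and a character $\tau:H\to\mathbb{C}^*$, the induced representation $\mathrm{Ind}_H^G(\tau)$ is the space $\{\phi:G\to\mathbb{C}\mid \phi(hx)=\tau(h)\phi(x)\ \forall h\in H,\ x\in G\}$ with $G$ acting by $(g\phi)(x)=\phi(xg)$. Exponents of $\omega$ are read modulo $3$. *)

theory Defs
  imports
    Complex_Main
    "HOL-Library.Numeral_Type"
    "HOL-Library.Function_Algebras"
    "HOL-Algebra.Group"
    "Jordan_Normal_Form.Matrix"
begin

section \<open>Complex representations of a group\<close>

definition linear_map_on ::
  "'v set \<Rightarrow> (complex \<Rightarrow> 'v \<Rightarrow> 'v) \<Rightarrow> (complex \<Rightarrow> 'w \<Rightarrow> 'w)
    \<Rightarrow> ('v::ab_group_add \<Rightarrow> 'w::ab_group_add) \<Rightarrow> bool"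
  where
  "linear_map_on V scl scl' f \<longleftrightarrow>
     (\<forall>x\<in>V. \<forall>y\<in>V. f (x + y) = f x + f y) \<and> (\<forall>c. \<forall>x\<in>V. f (scl c x) = scl' c (f x))"

text \<open>The representation space is a subspace \<open>V\<close>, of any dimension, of an ambient complex vector
  space (the type \<open>'v\<close> with scalar multiplication \<open>scl\<close>).  The values of \<open>\<rho> g v\<close> for \<open>g\<close> outside
  the group or \<open>v\<close> outside \<open>V\<close> are irrelevant.\<close>

definition representation ::
  "('g, 'm) monoid_scheme \<Rightarrow> (complex \<Rightarrow> 'v \<Rightarrow> 'v) \<Rightarrow> 'v::ab_group_add set
    \<Rightarrow> ('g \<Rightarrow> 'v \<Rightarrow> 'v) \<Rightarrow> bool"
  where
  "representation G scl V \<rho> \<longleftrightarrow>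
     group G \<and> vector_space scl \<and> module.subspace scl V \<and>
     (\<forall>g\<in>carrier G. \<rho> g \<in> V \<rightarrow> V \<and> linear_map_on V scl scl (\<rho> g)) \<and>
     (\<forall>v\<in>V. \<rho> \<one>\<^bsub>G\<^esub> v = v) \<and>
     (\<forall>g\<in>carrier G. \<forall>h\<in>carrier G. \<forall>v\<in>V. \<rho> (g \<otimes>\<^bsub>G\<^esub> h) v = \<rho> g (\<rho> h v))"

definition irreducible_rep ::
  "('g, 'm) monoid_scheme \<Rightarrow> (complex \<Rightarrow> 'v \<Rightarrow> 'v) \<Rightarrow> 'v::ab_group_add set
    \<Rightarrow> ('g \<Rightarrow> 'v \<Rightarrow> 'v) \<Rightarrow> bool"
  where
  "irreducible_rep G scl V \<rho> \<longleftrightarrow>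
     representation G scl V \<rho> \<and> V \<noteq> {0} \<and>
     (\<forall>W. W \<subseteq> V \<and> module.subspace scl W \<and> (\<forall>g\<in>carrier G. \<rho> g \<in> W \<rightarrow> W)
        \<longrightarrow> W = {0} \<or> W = V)"

definition rep_iso ::
  "('g, 'm) monoid_scheme
    \<Rightarrow> (complex \<Rightarrow> 'v \<Rightarrow> 'v) \<Rightarrow> 'v::ab_group_add set \<Rightarrow> ('g \<Rightarrow> 'v \<Rightarrow> 'v)
    \<Rightarrow> (complex \<Rightarrow> 'w \<Rightarrow> 'w) \<Rightarrow> 'w::ab_group_add set \<Rightarrow> ('g \<Rightarrow> 'w \<Rightarrow> 'w) \<Rightarrow> bool"
  where
  "rep_iso G scl V \<rho> scl' W \<sigma> \<longleftrightarrow>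
     (\<exists>f. bij_betw f V W \<and> linear_map_on V scl scl' f \<and>
          (\<forall>g\<in>carrier G. \<forall>v\<in>V. f (\<rho> g v) = \<sigma> g (f v)))"

text \<open>Isomorphism classes of the irreducible representations of \<open>G\<close> on subspaces of a fixed ambient
  space.  For a finite group the ambient space of complex functions on the type of group elements
  contains the regular representation, hence a copy of every irreducible representation.\<close>

definition irrep_classes ::
  "('g, 'm) monoid_scheme \<Rightarrow> (complex \<Rightarrow> 'v \<Rightarrow> 'v)
    \<Rightarrow> ('v::ab_group_add set \<times> ('g \<Rightarrow> 'v \<Rightarrow> 'v)) set set"
  where
  "irrep_classes G scl =
     {(V, \<rho>). irreducible_rep G scl V \<rho>} //
     {((V, \<rho>), (W, \<sigma>)). irreducible_rep G scl V \<rho> \<and> irreducible_rep G scl W \<sigma> \<and>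
                        rep_iso G scl V \<rho> scl W \<sigma>}"

section \<open>Induction of characters\<close>

definition C_star :: "complex monoid"
  where "C_star = \<lparr>carrier = UNIV - {0}, mult = (*), one = 1\<rparr>"

definition fun_scale :: "complex \<Rightarrow> ('a \<Rightarrow> complex) \<Rightarrow> 'a \<Rightarrow> complex"
  where "fun_scale c \<phi> = (\<lambda>x. c * \<phi> x)"

text \<open>A function \<open>carrier G \<Rightarrow> complex\<close> is encoded as a function on the whole type that vanishes
  outside \<open>carrier G\<close>.\<close>

definition ind_space ::
  "('g, 'm) monoid_scheme \<Rightarrow> 'g set \<Rightarrow> ('g \<Rightarrow> complex) \<Rightarrow> ('g \<Rightarrow> complex) set"
  where
  "ind_space G H \<tau> =
     {\<phi>. (\<forall>h\<in>H. \<forall>x\<in>carrier G. \<phi> (h \<otimes>\<^bsub>G\<^esub> x) = \<tau> h * \<phi> x) \<and> (\<forall>x. x \<notin> carrier G \<longrightarrow> \<phi> x = 0)}"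

definition ind_action ::
  "('g, 'm) monoid_scheme \<Rightarrow> 'g \<Rightarrow> ('g \<Rightarrow> complex) \<Rightarrow> 'g \<Rightarrow> complex"
  where
  "ind_action G g \<phi> = (\<lambda>x. if x \<in> carrier G then \<phi> (x \<otimes>\<^bsub>G\<^esub> g) else 0)"

section \<open>The group \<open>UT\<^sub>3(F\<^sub>3)\<close>\<close>

text \<open>The numeral type \<open>3\<close> is the ring of integers modulo 3; no type class \<open>field\<close> is available for
  it, but it is a field by \<open>F3_inverse\<close>.\<close>

type_synonym F3 = "3"

lemma F3_cases: "x = 0 \<or> x = 1 \<or> x = 2" for x :: F3
proof (cases x)
  case (of_int z)
  then have "0 \<le> z" "z < 3" by simp_all
  then have "z = 0 \<or> z = 1 \<or> z = 2" by linarith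
  then show ?thesis unfolding of_int(1) by (elim disjE) simp_all
qed

lemma F3_inverse: "x \<noteq> 0 \<Longrightarrow> x * x = 1" for x :: F3
  using F3_cases[of x] by (elim disjE) simp_all

definition UT :: "nat \<Rightarrow> 'a::comm_ring_1 mat monoid"
  where
  "UT n = \<lparr>carrier = {A \<in> carrier_mat n n. upper_triangular A \<and> (\<forall>i<n. A $$ (i, i) = 1)},
           mult = (*), one = 1\<^sub>m n\<rparr>"

abbreviation UT3 :: "F3 mat monoid"
  where "UT3 \<equiv> UT 3"

definition ut :: "F3 \<Rightarrow> F3 \<Rightarrow> F3 \<Rightarrow> F3 mat"
  where "ut a b c = mat_of_rows_list 3 [[1, a, b], [0, 1, c], [0, 0, 1]]"

definition H_ut :: "F3 mat set"
  where "H_ut = {ut 0 b c | b c. True}"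

definition omega :: complex
  where "omega = exp (2 * complex_of_real pi * \<i> / 3)"

text \<open>\<open>omega\<close> to an exponent in \<open>\<int>/3\<int>\<close>, by way of the least natural representative.\<close>

definition omega_pow :: "F3 \<Rightarrow> complex"
  where "omega_pow e = omega ^ (LEAST n. of_nat n = e)"

text \<open>In zero-based indexing the entries \<open>a\<close>, \<open>b\<close>, \<open>c\<close> of \<open>ut a b c\<close> sit at \<open>(0, 1)\<close>, \<open>(0, 2)\<close>,
  \<open>(1, 2)\<close>.\<close>

definition rho_lin :: "F3 \<Rightarrow> F3 \<Rightarrow> F3 mat \<Rightarrow> complex \<Rightarrow> complex"
  where "rho_lin r s A z = omega_pow (r * A $$ (0, 1) + s * A $$ (1, 2)) * z"

definition tau :: "F3 \<Rightarrow> F3 mat \<Rightarrow> complex"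
  where "tau k A = omega_pow (k * A $$ (0, 2))"

lemma less_3_nat: "i < 3 \<longleftrightarrow> i = 0 \<or> i = 1 \<or> i = 2" for i :: nat
  by linarith

lemma ut_entries:
  "ut a b c $$ (0, 0) = 1" "ut a b c $$ (0, 1) = a" "ut a b c $$ (0, 2) = b"
  "ut a b c $$ (1, 0) = 0" "ut a b c $$ (1, 1) = 1" "ut a b c $$ (1, 2) = c"
  "ut a b c $$ (2, 0) = 0" "ut a b c $$ (2, 1) = 0" "ut a b c $$ (2, 2) = 1"
  by (simp_all add: ut_def mat_of_rows_list_def)

lemma ut_dim: "ut a b c \<in> carrier_mat 3 3"
  unfolding ut_def mat_of_rows_list_def by (rule carrier_matI) simp_all

lemma carrier_UT3: "carrier UT3 = {ut a b c | a b c. True}"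
proof (intro equalityI subsetI)
  fix A assume "A \<in> carrier UT3"
  then have A: "A \<in> carrier_mat 3 3" "upper_triangular A" "\<forall>i<3. A $$ (i, i) = 1"
    by (simp_all add: UT_def)
  have low: "A $$ (1, 0) = 0" "A $$ (2, 0) = 0" "A $$ (2, 1) = 0"
    using A(1) by (intro upper_triangularD[OF A(2)]; simp)+
  have diag: "A $$ (0, 0) = 1" "A $$ (1, 1) = 1" "A $$ (2, 2) = 1"
    using A(3) by simp_all
  have "A = ut (A $$ (0, 1)) (A $$ (0, 2)) (A $$ (1, 2))" (is "_ = ?B")
  proof (rule eq_matI)
    have dim: "dim_row ?B = 3" "dim_col ?B = 3"
      using ut_dim by blast+
    show "dim_row A = dim_row ?B" "dim_col A = dim_col ?B"
      using A(1) dim by simp_all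
    fix i j assume "i < dim_row ?B" "j < dim_col ?B"
    then have "i = 0 \<or> i = 1 \<or> i = 2" "j = 0 \<or> j = 1 \<or> j = 2"
      unfolding dim less_3_nat by blast+
    then show "A $$ (i, j) = ?B $$ (i, j)"
      using low diag ut_entries by (elim disjE) (simp_all only:)
  qed
  then show "A \<in> {ut a b c | a b c. True}" by blast
next
  fix A assume "A \<in> {ut a b c | a b c. True}"
  then obtain a b c where A: "A = ut a b c" by blast
  have "upper_triangular A"
  proof (rule upper_triangularI)
    fix i j assume "j < i" "i < dim_row A"
    then have "j < i" "i < 3" using carrier_matD[OF ut_dim] A by auto
    then have "i = 1 \<and> j = 0 \<or> i = 2 \<and> j = 0 \<or> i = 2 \<and> j = 1" by auto
    then show "A $$ (i, j) = 0" unfolding A using ut_entries by metis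
  qed
  moreover have "\<forall>i<3. A $$ (i, i) = 1"
    unfolding A less_3_nat using ut_entries by metis
  moreover have "A \<in> carrier_mat 3 3"
    unfolding A by (rule ut_dim)
  ultimately show "A \<in> carrier UT3"
    unfolding UT_def partial_object.simps mem_Collect_eq by (intro conjI)
qed

lemma omega_pow_of_nat: "omega_pow (of_nat n) = omega ^ n"
proof -
  have "3 * (2 * complex_of_real pi * \<i> / 3) = 2 * complex_of_real pi * \<i>" by simp
  then have o3: "omega ^ 3 = 1"
    unfolding omega_def
    using exp_of_nat_mult[of 3 "2 * complex_of_real pi * \<i> / 3"] by (simp only: of_nat_numeral exp_two_pi_i)
  have red: "omega ^ m = omega ^ (m mod 3)" for m
  proof -
    have "omega ^ m = omega ^ (3 * (m div 3) + m mod 3)"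
      unfolding mult_div_mod_eq by (rule refl)
    also have "\<dots> = omega ^ (m mod 3)"
      unfolding power_add power_mult o3 by simp
    finally show ?thesis .
  qed
  have rep: "Rep_bit1 (of_nat m :: F3) = int (m mod 3)" for m
    by (simp add: bit1.of_nat_eq zmod_int Abs_bit1_inverse)
  let ?m = "LEAST m. of_nat m = (of_nat n :: F3)"
  have "(of_nat ?m :: F3) = of_nat n"
    by (rule LeastI) (rule refl)
  then have "int (?m mod 3) = int (n mod 3)"
    by (simp only: rep[symmetric])
  then have "omega ^ (?m mod 3) = omega ^ (n mod 3)"
    by (simp only: of_nat_eq_iff)
  then have "omega ^ ?m = omega ^ n"
    unfolding red[symmetric] .
  then show ?thesis
    unfolding omega_pow_def .
qed

abbreviation rho_ind_space :: "F3 \<Rightarrow> (F3 mat \<Rightarrow> complex) set"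
  where "rho_ind_space k \<equiv> ind_space UT3 H_ut (tau k)"

abbreviation rho_ind :: "F3 mat \<Rightarrow> (F3 mat \<Rightarrow> complex) \<Rightarrow> F3 mat \<Rightarrow> complex"
  where "rho_ind \<equiv> ind_action UT3"

end

theory Submission
  imports Defs
begin

text \<open>Operators \<open>T\<close> with \<open>T\<^sup>3 = 1\<close> have eigenvectors in every nonzero invariant subspace, of whatever
  dimension.  In an irreducible representation of \<open>UT\<^sub>3(F\<^sub>3)\<close> this yields a common eigenvector of
  the abelian normal subgroup \<open>H\<close>, where the center acts by \<open>\<omega>\<^sup>k\<^sup>b\<close>.  If \<open>k = 0\<close>, the elements
  \<open>g(a,0,0)\<close> preserve the eigenspace and there is an eigenvector of the whole group.  If \<open>k \<noteq> 0\<close>,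
  translating by some \<open>g(x,0,0)\<close> produces a vector on which \<open>H\<close> acts by \<open>\<tau>\<^sub>k\<close>.  Either vector defines
  a nonzero homomorphism from \<open>\<rho>\<^sub>r\<^sub>,\<^sub>s\<close> or \<open>Ind(\<tau>\<^sub>k)\<close>, which is an isomorphism by Schur's lemma.\<close>

section \<open>Characters of the integers modulo 3\<close>

lemma UNIV_F3: "(UNIV :: F3 set) = {0, 1, 2}"
  using F3_cases by auto

lemma sum_F3: "(\<Sum>x\<in>UNIV. f x) = f 0 + f 1 + f 2" for f :: "F3 \<Rightarrow> 'a::comm_monoid_add"
  unfolding UNIV_F3 by (simp add: add.assoc)

lemma of_nat_F3_surj: obtains n where "of_nat n = (x :: F3)"
proof -
  have "of_nat 0 = (0 :: F3)" "of_nat 1 = (1 :: F3)" "of_nat 2 = (2 :: F3)" by simp_all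
  then show thesis using that F3_cases[of x] by blast
qed

lemma omega_pow_0 [simp]: "omega_pow 0 = 1"
  using omega_pow_of_nat[of 0] by simp

text \<open>Least representatives are not additive, so both exponents are lifted to naturals and
  \<open>omega_pow_of_nat\<close> absorbs the reduction modulo 3.\<close>

lemma omega_pow_add: "omega_pow (x + y) = omega_pow x * omega_pow y"
proof -
  obtain m n where "of_nat m = x" "of_nat n = y" using of_nat_F3_surj by metis
  then show ?thesis
    using omega_pow_of_nat[of m] omega_pow_of_nat[of n] omega_pow_of_nat[of "m + n"]
    by (simp add: power_add)
qed

lemma omega_pow_nonzero [simp]: "omega_pow x \<noteq> 0"
  using omega_pow_add[of x "- x"] by auto

lemma omega_pow_1: "omega_pow 1 = omega" and omega_pow_2: "omega_pow 2 = omega\<^sup>2"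
  using omega_pow_of_nat[of 1] omega_pow_of_nat[of 2] by simp_all

text \<open>The imaginary part is the sine of an angle strictly between 0 and \<pi>.\<close>

lemma omega_neq_1: "omega \<noteq> 1"
proof -
  have "omega = cis (2 * pi / 3)"
    unfolding omega_def cis_conv_exp by (simp add: mult.commute)
  moreover have "sin (2 * pi / 3) > 0"
    by (rule sin_gt_zero) simp_all
  ultimately show ?thesis by (metis cis.sel(2) less_irrefl one_complex.sel(2))
qed

lemma omega_cube: "omega ^ 3 = 1"
proof -
  have "(of_nat 3 :: F3) = 0" by simp
  then show ?thesis using omega_pow_of_nat[of 3] omega_pow_0 by metis
qed

lemma omega_pow_eq_1_iff: "omega_pow x = 1 \<longleftrightarrow> x = 0"
proof -
  \<comment> \<open>Otherwise \<open>omega = omega ^ 3 = 1\<close>.\<close>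
  have "omega\<^sup>2 \<noteq> 1"
    using omega_cube omega_neq_1 by (metis mult_1_left power2_eq_square power3_eq_cube)
  then show ?thesis
    using F3_cases[of x] omega_neq_1 omega_pow_1 omega_pow_2 by auto
qed

lemma omega_pow_eq_iff: "omega_pow x = omega_pow y \<longleftrightarrow> x = y"
proof -
  have "omega_pow x = omega_pow (x - y) * omega_pow y"
    by (simp flip: omega_pow_add)
  then show ?thesis
    using omega_pow_eq_1_iff[of "x - y"] by auto
qed

text \<open>Character orthogonality for the integers modulo 3: for \<open>y\<close> nonzero the
  terms are the three cube roots of unity, whose sum is a factor of
  \<open>omega ^ 3 - 1\<close>.\<close>

lemma sum_omega_pow: "(\<Sum>x\<in>UNIV. omega_pow (x * y)) = (if y = 0 then 3 else 0)"
proof -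
  have "(omega - 1) * (1 + omega + omega\<^sup>2) = omega ^ 3 - 1"
    by (simp add: algebra_simps power2_eq_square power3_eq_cube)
  then have "1 + omega + omega\<^sup>2 = 0"
    using omega_neq_1 omega_cube by simp
  \<comment> \<open>For \<open>y = 2\<close> the last exponent is 4, which has to be reduced to
    1.\<close>
  moreover have "(2 :: F3) * 2 = 1" by simp
  then have "omega_pow (2 * 2) = omega" by (simp only: omega_pow_1)
  ultimately show ?thesis
    using F3_cases[of y]
    by (elim disjE) (simp_all add: sum_F3 omega_pow_1 omega_pow_2 algebra_simps)
qed

section \<open>The group \<open>UT\<^sub>3(F\<^sub>3)\<close>\<close>

lemma ut_in_carrier [simp]: "ut a b c \<in> carrier UT3"
  unfolding carrier_UT3 by blast

lemma ut_cases: assumes "A \<in> carrier UT3" obtains a b c where "A = ut a b c"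
  using assms unfolding carrier_UT3 by blast

lemma ut_eq_iff: "ut a b c = ut a' b' c' \<longleftrightarrow> a = a' \<and> b = b' \<and> c = c'"
  using ut_entries by metis

text \<open>Only the corner entry mixes coordinates. The term \<open>a * c'\<close> is the source of
  every commutation relation used below.\<close>

lemma ut_mult: "ut a b c * ut a' b' c' = ut (a + a') (b + b' + a * c') (c + c')"
proof (rule eq_matI)
  let ?A = "ut a b c" and ?B = "ut a' b' c'" and ?C = "ut (a + a') (b + b' + a * c') (c + c')"
  show "dim_row (?A * ?B) = dim_row ?C" "dim_col (?A * ?B) = dim_col ?C"
    using carrier_matD[OF ut_dim] by auto
  fix i j assume "i < dim_row ?C" "j < dim_col ?C"
  then have ij: "i < 3" "j < 3"
    using carrier_matD[OF ut_dim] by auto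
  have "(?A * ?B) $$ (i, j) = (\<Sum>l = 0..<3. ?A $$ (i, l) * ?B $$ (l, j))"
    using ij carrier_matD[OF ut_dim] by (simp add: scalar_prod_def)
  also have "\<dots> = ?A $$ (i, 0) * ?B $$ (0, j) + ?A $$ (i, 1) * ?B $$ (1, j) + ?A $$ (i, 2) * ?B $$ (2, j)"
    by (simp add: numeral_3_eq_3 numeral_2_eq_2)
  also have "\<dots> = ?C $$ (i, j)"
    using ij unfolding less_3_nat
    by (elim disjE) (simp_all only: ut_entries, simp_all add: algebra_simps)
  finally show "(?A * ?B) $$ (i, j) = ?C $$ (i, j)" .
qed

lemma mult_UT3 [simp]: "A \<otimes>\<^bsub>UT3\<^esub> B = A * B"
  by (simp add: UT_def)

lemma one_UT3: "\<one>\<^bsub>UT3\<^esub> = ut 0 0 0"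
proof -
  have "(1\<^sub>m 3 :: F3 mat) \<in> carrier UT3"
    by (simp add: UT_def upper_triangular_def)
  then obtain a b c where abc: "1\<^sub>m 3 = ut a b c" by (rule ut_cases)
  have "(1\<^sub>m 3 :: F3 mat) $$ (0, 1) = 0" "(1\<^sub>m 3 :: F3 mat) $$ (0, 2) = 0"
    "(1\<^sub>m 3 :: F3 mat) $$ (1, 2) = 0" by simp_all
  then show ?thesis
    unfolding abc ut_entries by (simp add: UT_def abc)
qed

lemma group_UT3: "group UT3"
proof (rule groupI)
  fix A B C assume "A \<in> carrier UT3" "B \<in> carrier UT3" "C \<in> carrier UT3"
  then obtain a b c a' b' c' a'' b'' c''
    where "A = ut a b c" "B = ut a' b' c'" "C = ut a'' b'' c''"
    by (meson ut_cases)
  then show "A \<otimes>\<^bsub>UT3\<^esub> B \<otimes>\<^bsub>UT3\<^esub> C = A \<otimes>\<^bsub>UT3\<^esub> (B \<otimes>\<^bsub>UT3\<^esub> C)"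
    by (simp add: ut_mult algebra_simps)
next
  fix A B assume "A \<in> carrier UT3" "B \<in> carrier UT3"
  then show "A \<otimes>\<^bsub>UT3\<^esub> B \<in> carrier UT3" by (auto elim!: ut_cases simp: ut_mult)
next
  fix A assume "A \<in> carrier UT3"
  then obtain a b c where A: "A = ut a b c" by (rule ut_cases)
  show "\<one>\<^bsub>UT3\<^esub> \<otimes>\<^bsub>UT3\<^esub> A = A" by (simp add: A one_UT3 ut_mult)
  \<comment> \<open>The corner entry also has to cancel the mixed term \<open>- a * c\<close> of
    this product.\<close>
  have "ut (- a) (a * c - b) (- c) \<otimes>\<^bsub>UT3\<^esub> A = \<one>\<^bsub>UT3\<^esub>"
    by (simp add: A one_UT3 ut_mult)
  then show "\<exists>B\<in>carrier UT3. B \<otimes>\<^bsub>UT3\<^esub> A = \<one>\<^bsub>UT3\<^esub>" using ut_in_carrier by blast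
qed (simp add: one_UT3)

lemma subgroup_H_ut: "subgroup H_ut UT3"
proof (rule group.subgroupI[OF group_UT3])
  show "H_ut \<subseteq> carrier UT3" "H_ut \<noteq> {}" unfolding H_ut_def by auto
  fix A B assume "A \<in> H_ut"
  then obtain b c where A: "A = ut 0 b c" unfolding H_ut_def by blast
  have "inv\<^bsub>UT3\<^esub> A = ut 0 (- b) (- c)"
    by (rule group.inv_equality[OF group_UT3]) (simp_all add: A one_UT3 ut_mult)
  then show "inv\<^bsub>UT3\<^esub> A \<in> H_ut" unfolding H_ut_def by blast
  assume "B \<in> H_ut"
  then show "A \<otimes>\<^bsub>UT3\<^esub> B \<in> H_ut" unfolding H_ut_def by (auto simp: A ut_mult ut_eq_iff)
qed

lemma tau_ut: "tau k (ut a b c) = omega_pow (k * b)"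
  unfolding tau_def ut_entries ..

lemma tau_hom: "tau k \<in> hom (UT3\<lparr>carrier := H_ut\<rparr>) C_star"
  by (rule homI) (auto simp: H_ut_def C_star_def ut_mult tau_ut algebra_simps omega_pow_add)

section \<open>Representations\<close>

lemma representation_vector_space: "representation G scl V \<rho> \<Longrightarrow> vector_space scl"
  unfolding representation_def by auto

lemma irreducible_repD: "irreducible_rep G scl V \<rho> \<Longrightarrow> representation G scl V \<rho>"
  unfolding irreducible_rep_def by blast

lemma irreducible_rep_invariant_subspace:
  assumes "irreducible_rep G scl V \<rho>" "W \<subseteq> V" "module.subspace scl W"
    and "\<And>g w. g \<in> carrier G \<Longrightarrow> w \<in> W \<Longrightarrow> \<rho> g w \<in> W"
  shows "W = {0} \<or> W = V"
  using assms unfolding irreducible_rep_def Pi_def by simp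

lemma irreducible_repI:
  assumes "representation G scl V \<rho>" "V \<noteq> {0}"
    and "\<And>W. W \<subseteq> V \<Longrightarrow> module.subspace scl W \<Longrightarrow>
      (\<And>g w. g \<in> carrier G \<Longrightarrow> w \<in> W \<Longrightarrow> \<rho> g w \<in> W) \<Longrightarrow> W \<noteq> {0} \<Longrightarrow> W = V"
  shows "irreducible_rep G scl V \<rho>"
  unfolding irreducible_rep_def
proof (intro conjI allI impI)
  fix W assume "W \<subseteq> V \<and> module.subspace scl W \<and> (\<forall>g\<in>carrier G. \<rho> g \<in> W \<rightarrow> W)"
  then show "W = {0} \<or> W = V"
    using assms(3)[of W] by (cases "W = {0}") (simp_all add: Pi_iff)
qed (rule assms)+

text \<open>Makes subspaces, spans and sums available next to the action. The name is qualified
  because inside \<open>vector_space\<close> the word \<open>representation\<close> means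
  coordinates with respect to a basis.\<close>

locale complex_representation = vector_space scl
  for scl :: "complex \<Rightarrow> 'v::ab_group_add \<Rightarrow> 'v"
    and G :: "('g, 'm) monoid_scheme" and V and \<rho> +
  assumes rep: "Defs.representation G scl V \<rho>"
begin

lemma
  shows rep_subspace: "subspace V"
    and rep_closed: "g \<in> carrier G \<Longrightarrow> v \<in> V \<Longrightarrow> \<rho> g v \<in> V"
    and rep_add: "g \<in> carrier G \<Longrightarrow> v \<in> V \<Longrightarrow> w \<in> V \<Longrightarrow> \<rho> g (v + w) = \<rho> g v + \<rho> g w"
    and rep_scale: "g \<in> carrier G \<Longrightarrow> v \<in> V \<Longrightarrow> \<rho> g (scl c v) = scl c (\<rho> g v)"
    and rep_one: "v \<in> V \<Longrightarrow> \<rho> \<one>\<^bsub>G\<^esub> v = v"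
    and rep_mult: "g \<in> carrier G \<Longrightarrow> h \<in> carrier G \<Longrightarrow> v \<in> V \<Longrightarrow> \<rho> (g \<otimes>\<^bsub>G\<^esub> h) v = \<rho> g (\<rho> h v)"
  using rep unfolding Defs.representation_def linear_map_on_def by auto

lemma rep_zero: "g \<in> carrier G \<Longrightarrow> \<rho> g 0 = 0"
  using rep_scale[of g 0 0] subspace_0[OF rep_subspace] by simp

lemma rep_sum:
  assumes "g \<in> carrier G" "\<And>i. i \<in> I \<Longrightarrow> f i \<in> V"
  shows "\<rho> g (\<Sum>i\<in>I. f i) = (\<Sum>i\<in>I. \<rho> g (f i))"
  using assms(2)
proof (induction I rule: infinite_finite_induct)
  case (insert i I)
  then have "(\<Sum>i\<in>I. f i) \<in> V" by (intro subspace_sum[OF rep_subspace]) auto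
  with insert show ?case by (simp add: rep_add assms(1))
qed (simp_all add: rep_zero assms(1))

text \<open>The Fourier components of a vector \<open>v\<close> under a homomorphic image of \<open>\<int>/3\<close> are
  eigenvectors, and they sum up to \<open>3 v\<close>, so one of them does not vanish.\<close>

lemma exists_eigenvector:
  fixes \<gamma> :: "F3 \<Rightarrow> 'g"
  assumes \<gamma>: "\<And>x. \<gamma> x \<in> carrier G" "\<And>x y. \<gamma> (x + y) = \<gamma> x \<otimes>\<^bsub>G\<^esub> \<gamma> y" "\<gamma> 0 = \<one>\<^bsub>G\<^esub>"
    and W: "subspace W" "W \<subseteq> V" "W \<noteq> {0}" "\<And>x w. w \<in> W \<Longrightarrow> \<rho> (\<gamma> x) w \<in> W"
  obtains j w where "w \<in> W" "w \<noteq> 0" "\<And>x. \<rho> (\<gamma> x) w = scl (omega_pow (j * x)) w"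
proof -
  obtain v where v: "v \<in> W" "v \<noteq> 0" using W(1,3) subspace_0 by blast
  then have "v \<in> V" using W(2) by blast
  define P where "P j = (\<Sum>x\<in>UNIV. scl (omega_pow (j * - x)) (\<rho> (\<gamma> x) v))" for j
  \<comment> \<open>After exchanging the sums, orthogonality leaves only \<open>x = 0\<close>, where
    \<open>\<gamma> 0\<close> acts as the identity.\<close>
  have "(\<Sum>j\<in>UNIV. P j) = (\<Sum>x\<in>UNIV. scl (\<Sum>j\<in>UNIV. omega_pow (j * - x)) (\<rho> (\<gamma> x) v))"
    unfolding P_def scale_sum_left by (rule sum.swap)
  also have "\<dots> = scl 3 v"
    unfolding sum_omega_pow by (simp add: if_distribR sum_F3 \<gamma>(3) rep_one \<open>v \<in> V\<close>)
  finally have "(\<Sum>j\<in>UNIV. P j) \<noteq> 0" using v(2) by simp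
  then obtain j where j: "P j \<noteq> 0" by (metis sum.neutral)
  have "\<rho> (\<gamma> y) (P j) = scl (omega_pow (j * y)) (P j)" for y
  proof -
    have "\<rho> (\<gamma> y) (P j) = (\<Sum>x\<in>UNIV. scl (omega_pow (j * - x)) (\<rho> (\<gamma> (y + x)) v))"
      unfolding P_def
      by (subst rep_sum)
        (simp_all add: \<gamma>(1,2) rep_mult rep_scale rep_closed subspace_scale[OF rep_subspace] \<open>v \<in> V\<close>)
    \<comment> \<open>Splitting off the eigenvalue leaves a summand that depends on
      \<open>y + x\<close> alone, so the sum can be shifted.\<close>
    also have "\<dots> = (\<Sum>x\<in>UNIV. scl (omega_pow (j * y) * omega_pow (j * - (y + x))) (\<rho> (\<gamma> (y + x)) v))"
      by (simp add: omega_pow_add[symmetric] algebra_simps)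
    also have "\<dots> = (\<Sum>x\<in>UNIV. scl (omega_pow (j * y) * omega_pow (j * - x)) (\<rho> (\<gamma> x) v))"
      by (rule sum.reindex_bij_betw) (rule bij_plus)
    finally show ?thesis unfolding P_def by (simp add: scale_sum_right)
  qed
  moreover have "P j \<in> W"
    unfolding P_def using v(1) W(1,4) by (intro subspace_sum subspace_scale)
  ultimately show thesis using that j by blast
qed

end

lemma complex_representationI: "representation G scl V \<rho> \<Longrightarrow> complex_representation scl G V \<rho>"
  unfolding complex_representation_def complex_representation_axioms_def
  by (simp add: representation_vector_space)

section \<open>Intertwining maps and isomorphism of representations\<close>

lemma linear_map_on_zero:
  assumes "vector_space scl" "vector_space scl'" "module.subspace scl V" "linear_map_on V scl scl' f"
  shows "f 0 = 0"
proof -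
  interpret V: vector_space scl by fact
  interpret W: vector_space scl' by fact
  have "f (scl 0 0) = scl' 0 (f 0)"
    using assms(4) V.subspace_0[OF assms(3)] unfolding linear_map_on_def by blast
  then show ?thesis by simp
qed

text \<open>Schur's lemma: kernel and image of \<open>f\<close> are invariant subspaces, and
  \<open>f v \<noteq> 0\<close> excludes that the kernel is everything or the image zero. No
  finiteness of dimension enters.\<close>

lemma rep_isoI_Schur:
  assumes V: "irreducible_rep G scl V \<rho>" and W: "irreducible_rep G scl' W \<sigma>"
    and f: "f \<in> V \<rightarrow> W" "linear_map_on V scl scl' f"
    and equiv: "\<And>g v. g \<in> carrier G \<Longrightarrow> v \<in> V \<Longrightarrow> f (\<rho> g v) = \<sigma> g (f v)"
    and nz: "v \<in> V" "f v \<noteq> 0"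
  shows "rep_iso G scl V \<rho> scl' W \<sigma>"
proof -
  interpret V: complex_representation scl G V \<rho>
    using V by (intro complex_representationI irreducible_repD)
  interpret W: complex_representation scl' G W \<sigma>
    using W by (intro complex_representationI irreducible_repD)
  have f_add: "f (x + y) = f x + f y" if "x \<in> V" "y \<in> V" for x y
    using f(2) that unfolding linear_map_on_def by blast
  have f_scale: "f (scl c x) = scl' c (f x)" if "x \<in> V" for x c
    using f(2) that unfolding linear_map_on_def by blast
  have f0: "f 0 = 0"
    by (rule linear_map_on_zero[OF V.vector_space_axioms W.vector_space_axioms V.rep_subspace f(2)])
  note V_closed = V.subspace_add[OF V.rep_subspace] V.subspace_scale[OF V.rep_subspace]
    V.subspace_0[OF V.rep_subspace] V.rep_closed
  let ?K = "{x \<in> V. f x = 0}"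
  have "?K = {0} \<or> ?K = V"
  proof (rule irreducible_rep_invariant_subspace[OF V])
    show "V.subspace ?K"
      by (rule V.subspaceI) (auto simp: f_add f_scale f0 V_closed)
  qed (auto simp: equiv V_closed W.rep_zero)
  then have K: "?K = {0}" using nz by blast
  have "inj_on f V"
  proof (rule inj_onI)
    fix x y assume xy: "x \<in> V" "y \<in> V" "f x = f y"
    \<comment> \<open>Linearity on \<open>V\<close> speaks of sums and multiples only, so the
      difference is written with the scalar -1.\<close>
    have mem: "scl (- 1) y \<in> V" "x + scl (- 1) y \<in> V"
      using xy V_closed(1,2) by blast+
    have "f (x + scl (- 1) y) = f x + scl' (- 1) (f y)"
      by (simp only: f_add[OF xy(1) mem(1)] f_scale[OF xy(2)])
    also have "\<dots> = 0" using xy(3) by simp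
    finally have "x + scl (- 1) y = 0"
      using K mem(2) by blast
    then show "x = y" by simp
  qed
  moreover have "f ` V = {0} \<or> f ` V = W"
  proof (rule irreducible_rep_invariant_subspace[OF W])
    show "W.subspace (f ` V)"
    proof (rule W.subspaceI)
      show "0 \<in> f ` V" using f0 V_closed(3) by (metis imageI)
      show "x + y \<in> f ` V" if "x \<in> f ` V" "y \<in> f ` V" for x y
        using that V_closed(1) f_add by (metis (no_types, lifting) imageE imageI)
      show "scl' c x \<in> f ` V" if "x \<in> f ` V" for c x
        using that V_closed(2) f_scale by (metis (no_types, lifting) imageE imageI)
    qed
    show "\<sigma> g w \<in> f ` V" if "g \<in> carrier G" "w \<in> f ` V" for g w
      using that V_closed(4) equiv by (metis (no_types, lifting) imageE imageI)
  qed (use f(1) in blast)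
  then have "f ` V = W" using nz by blast
  ultimately show ?thesis
    unfolding rep_iso_def bij_betw_def using f(2) equiv by blast
qed

lemma rep_iso_refl: "rep_iso G scl V \<rho> scl V \<rho>"
  unfolding rep_iso_def linear_map_on_def by (intro exI[of _ id]) simp

lemma rep_iso_trans:
  assumes "rep_iso G scl V \<rho> scl' W \<sigma>" "rep_iso G scl' W \<sigma> scl'' U \<tau>"
  shows "rep_iso G scl V \<rho> scl'' U \<tau>"
proof -
  obtain f where f: "bij_betw f V W" "linear_map_on V scl scl' f"
    "\<forall>g\<in>carrier G. \<forall>v\<in>V. f (\<rho> g v) = \<sigma> g (f v)"
    using assms(1) unfolding rep_iso_def by blast
  obtain h where h: "bij_betw h W U" "linear_map_on W scl' scl'' h"
    "\<forall>g\<in>carrier G. \<forall>v\<in>W. h (\<sigma> g v) = \<tau> g (h v)"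
    using assms(2) unfolding rep_iso_def by blast
  have fW: "f v \<in> W" if "v \<in> V" for v using f(1) that by (rule bij_betw_apply)
  have "bij_betw (h \<circ> f) V U" using f(1) h(1) by (rule bij_betw_trans)
  moreover have "linear_map_on V scl scl'' (h \<circ> f)"
    using f(2) h(2) fW unfolding linear_map_on_def by simp
  moreover have "\<forall>g\<in>carrier G. \<forall>v\<in>V. (h \<circ> f) (\<rho> g v) = \<tau> g ((h \<circ> f) v)"
    using f(3) h(3) fW by simp
  ultimately show ?thesis unfolding rep_iso_def by blast
qed

text \<open>The hypothesis on \<open>V\<close> keeps sums, multiples and translates inside
  \<open>V\<close>, where the chosen inverse cancels \<open>f\<close>.\<close>

lemma rep_iso_sym:
  assumes V: "representation G scl V \<rho>" and iso: "rep_iso G scl V \<rho> scl' W \<sigma>"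
  shows "rep_iso G scl' W \<sigma> scl V \<rho>"
proof -
  interpret V: complex_representation scl G V \<rho>
    using V by (rule complex_representationI)
  obtain f where f: "bij_betw f V W" "linear_map_on V scl scl' f"
    "\<forall>g\<in>carrier G. \<forall>v\<in>V. f (\<rho> g v) = \<sigma> g (f v)"
    using iso unfolding rep_iso_def by blast
  let ?h = "inv_into V f"
  have h: "bij_betw ?h W V" using f(1) by (rule bij_betw_inv_into)
  have hf: "?h (f v) = v" if "v \<in> V" for v
    using that f(1) by (metis bij_betw_inv_into_left)
  have W: "w \<in> f ` V" if "w \<in> W" for w
    using that f(1) by (metis bij_betw_imp_surj_on)
  have "linear_map_on W scl' scl ?h"
    unfolding linear_map_on_def
  proof (intro conjI ballI allI)
    fix w w' assume "w \<in> W" "w' \<in> W"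
    then obtain v v' where v: "v \<in> V" "w = f v" "v' \<in> V" "w' = f v'" using W by blast
    then have "w + w' = f (v + v')" using f(2) unfolding linear_map_on_def by simp
    then show "?h (w + w') = ?h w + ?h w'"
      using v by (simp add: hf V.subspace_add[OF V.rep_subspace])
  next
    fix c w assume "w \<in> W"
    then obtain v where v: "v \<in> V" "w = f v" using W by blast
    then have "scl' c w = f (scl c v)" using f(2) unfolding linear_map_on_def by simp
    then show "?h (scl' c w) = scl c (?h w)"
      using v by (simp add: hf V.subspace_scale[OF V.rep_subspace])
  qed
  moreover have "?h (\<sigma> g w) = \<rho> g (?h w)" if gw: "g \<in> carrier G" "w \<in> W" for g w
  proof -
    obtain v where v: "v \<in> V" "w = f v" using gw(2) W by blast
    then have "\<sigma> g w = f (\<rho> g v)" using f(3) gw(1) by simp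
    then show ?thesis using v gw(1) by (simp add: hf V.rep_closed)
  qed
  ultimately show ?thesis unfolding rep_iso_def using h by blast
qed

text \<open>The invariant that separates the representations: the image of a nonzero vector is
  nonzero and is multiplied by both scalars.\<close>

lemma rep_iso_scalar_eq:
  assumes V: "irreducible_rep G scl V \<rho>" and W: "irreducible_rep G scl' W \<sigma>"
    and iso: "rep_iso G scl V \<rho> scl' W \<sigma>" and g: "g \<in> carrier G"
    and "\<And>v. v \<in> V \<Longrightarrow> \<rho> g v = scl c v" "\<And>w. w \<in> W \<Longrightarrow> \<sigma> g w = scl' c' w"
  shows "c = c'"
proof -
  interpret V: complex_representation scl G V \<rho>
    using V by (intro complex_representationI irreducible_repD)
  interpret W: complex_representation scl' G W \<sigma>
    using W by (intro complex_representationI irreducible_repD)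
  obtain f where f: "bij_betw f V W" "linear_map_on V scl scl' f"
    "\<forall>g\<in>carrier G. \<forall>v\<in>V. f (\<rho> g v) = \<sigma> g (f v)"
    using iso unfolding rep_iso_def by blast
  have zero: "0 \<in> V" using V.rep_subspace by (rule V.subspace_0)
  then obtain v where v: "v \<in> V" "v \<noteq> 0"
    using V unfolding irreducible_rep_def by blast
  have "f 0 = 0"
    by (rule linear_map_on_zero[OF V.vector_space_axioms W.vector_space_axioms V.rep_subspace f(2)])
  then have "f v \<noteq> 0" using f(1) v zero by (metis bij_betw_imp_inj_on inj_on_eq_iff)
  moreover have "scl' c (f v) = scl' c' (f v)"
    using f v g assms(5,6) bij_betw_apply[OF f(1)] unfolding linear_map_on_def by metis
  ultimately show ?thesis by simp
qed

text \<open>A nonzero vector of a line spans it. The ambient space is arbitrary so that both the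
  complex numbers and a line of functions are covered.\<close>

lemma irreducible_rep_character:
  assumes G: "group G" and vs: "vector_space scl" and v: "v \<noteq> 0"
    and \<chi>: "\<chi> \<one>\<^bsub>G\<^esub> = 1" "\<And>g h. g \<in> carrier G \<Longrightarrow> h \<in> carrier G \<Longrightarrow> \<chi> (g \<otimes>\<^bsub>G\<^esub> h) = \<chi> g * \<chi> h"
  shows "irreducible_rep G scl (range (\<lambda>z. scl z v)) (\<lambda>g. scl (\<chi> g))"
proof -
  interpret vector_space scl by fact
  let ?L = "range (\<lambda>z. scl z v)"
  have L: "?L = span {v}" by (rule span_singleton[symmetric])
  show ?thesis
  proof (rule irreducible_repI)
    show "Defs.representation G scl ?L (\<lambda>g. scl (\<chi> g))"
      unfolding Defs.representation_def linear_map_on_def L using G vs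
      by (auto simp: \<chi> span_scale scale_right_distrib mult.commute)
    show "?L \<noteq> {0}" using v by (metis rangeI scale_one singletonD)
    fix W assume W: "W \<subseteq> ?L" "subspace W" "W \<noteq> {0}"
    then obtain w where w: "w \<in> W" "w \<noteq> 0" using subspace_0 by blast
    then obtain z where z: "w = scl z v" "z \<noteq> 0" using W(1) by force
    have "scl y v \<in> W" for y
      using subspace_scale[OF W(2) w(1), of "y / z"] z by simp
    then show "W = ?L" using W(1) by blast
  qed
qed

text \<open>Reduces counting isomorphism classes to a list of pairwise inequivalent representatives
  that meets every class.\<close>

lemma card_quotient_transversal:
  assumes R: "equiv A R" and f: "\<And>i. i \<in> I \<Longrightarrow> f i \<in> A"
    and inj: "\<And>i j. i \<in> I \<Longrightarrow> j \<in> I \<Longrightarrow> (f i, f j) \<in> R \<Longrightarrow> i = j"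
    and surj: "\<And>a. a \<in> A \<Longrightarrow> \<exists>i\<in>I. (a, f i) \<in> R"
  shows "card (A // R) = card I"
proof -
  have "bij_betw (\<lambda>i. R `` {f i}) I (A // R)"
    unfolding bij_betw_def
  proof
    show "inj_on (\<lambda>i. R `` {f i}) I"
      using f inj eq_equiv_class_iff[OF R] by (intro inj_onI) blast
    show "(\<lambda>i. R `` {f i}) ` I = A // R"
    proof (intro equalityI subsetI)
      fix X assume "X \<in> A // R"
      then obtain a where a: "a \<in> A" "X = R `` {a}" by (rule quotientE)
      then obtain i where "i \<in> I" "(a, f i) \<in> R" using surj by blast
      then show "X \<in> (\<lambda>i. R `` {f i}) ` I" using a equiv_class_eq[OF R] by blast
    qed (auto intro: quotientI f)
  qed
  then show ?thesis by (simp add: bij_betw_same_card)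
qed

section \<open>The induced representations\<close>

lemma vector_space_complex: "vector_space ((*) :: complex \<Rightarrow> complex \<Rightarrow> complex)"
  by unfold_locales (simp_all add: algebra_simps)

lemma vector_space_fun_scale: "vector_space (fun_scale :: complex \<Rightarrow> ('a \<Rightarrow> complex) \<Rightarrow> 'a \<Rightarrow> complex)"
  by unfold_locales (simp_all add: fun_eq_iff fun_scale_def algebra_simps)

lemma fun_scale_apply [simp]: "fun_scale c \<phi> x = c * \<phi> x"
  by (simp add: fun_scale_def)

lemma sum_fun_apply: "(\<Sum>i\<in>I. f i) x = (\<Sum>i\<in>I. f i x)" for f :: "'i \<Rightarrow> 'a \<Rightarrow> 'b::comm_monoid_add"
  by (induction I rule: infinite_finite_induct) simp_all

text \<open>Exhibits the \<open>ut a 0 0\<close> as representatives of the cosets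
  \<open>H x\<close>, so that three values determine an element of the induced space.\<close>

lemma H_ut_mult: "ut 0 b c * ut a 0 0 = ut a b c"
  by (simp add: ut_mult)

lemma rho_ind_space_ut:
  assumes "\<phi> \<in> rho_ind_space k"
  shows "\<phi> (ut a b c) = omega_pow (k * b) * \<phi> (ut a 0 0)"
proof -
  have "ut 0 b c \<in> H_ut" unfolding H_ut_def by blast
  then have "\<phi> (ut 0 b c \<otimes>\<^bsub>UT3\<^esub> ut a 0 0) = tau k (ut 0 b c) * \<phi> (ut a 0 0)"
    using assms unfolding ind_space_def by auto
  then show ?thesis by (simp add: H_ut_mult tau_ut)
qed

lemma rho_ind_space_eqI:
  assumes "\<phi> \<in> rho_ind_space k" "\<psi> \<in> rho_ind_space k" "\<And>n. \<phi> (ut n 0 0) = \<psi> (ut n 0 0)"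
  shows "\<phi> = \<psi>"
proof
  fix A show "\<phi> A = \<psi> A"
  proof (cases "A \<in> carrier UT3")
    case True
    then obtain a b c where "A = ut a b c" by (rule ut_cases)
    then show ?thesis
      using rho_ind_space_ut[OF assms(1)] rho_ind_space_ut[OF assms(2)] assms(3) by metis
  next
    case False
    then show ?thesis using assms(1,2) unfolding ind_space_def by auto
  qed
qed

text \<open>The element of \<open>rho_ind_space k\<close> with prescribed values \<open>u n\<close>
  at the coset representatives \<open>ut n 0 0\<close>, extended by zero outside the group.\<close>

definition ind_fun :: "F3 \<Rightarrow> (F3 \<Rightarrow> complex) \<Rightarrow> F3 mat \<Rightarrow> complex"
  where "ind_fun k u A =
    (if A \<in> carrier UT3 then omega_pow (k * A $$ (0, 2)) * u (A $$ (0, 1)) else 0)"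

lemma ind_fun_ut: "ind_fun k u (ut a b c) = omega_pow (k * b) * u a"
  unfolding ind_fun_def ut_entries by simp

lemma ind_fun_in_space: "ind_fun k u \<in> rho_ind_space k"
  unfolding ind_space_def
proof (intro CollectI conjI ballI allI impI)
  fix h x assume "h \<in> H_ut" "x \<in> carrier UT3"
  then obtain b c a' b' c' where "h = ut 0 b c" "x = ut a' b' c'"
    unfolding H_ut_def carrier_UT3 by blast
  then show "ind_fun k u (h \<otimes>\<^bsub>UT3\<^esub> x) = tau k h * ind_fun k u x"
    by (simp add: ut_mult ind_fun_ut tau_ut omega_pow_add algebra_simps)
next
  fix x assume "x \<notin> carrier UT3"
  then show "ind_fun k u x = 0" by (simp add: ind_fun_def)
qed

text \<open>Right multiplication of \<open>ut n 0 0\<close> by \<open>ut a b c\<close> gives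
  \<open>ut (n + a) (b + n * c) c\<close>, and \<open>tau k\<close> sees only the corner
  entry.\<close>

lemma rho_ind_ut:
  assumes "\<phi> \<in> rho_ind_space k"
  shows "rho_ind (ut a b c) \<phi> (ut n 0 0) = omega_pow (k * (b + n * c)) * \<phi> (ut (a + n) 0 0)"
  using rho_ind_space_ut[OF assms, of "n + a" "b + n * c" c]
  by (simp add: ind_action_def ut_mult add.commute)

text \<open>The functional equation concerns left multiplication and the action right
  multiplication, so the two are compatible by associativity.\<close>

lemma rho_ind_representation: "representation UT3 fun_scale (rho_ind_space k) rho_ind"
proof -
  interpret vector_space "fun_scale :: complex \<Rightarrow> (F3 mat \<Rightarrow> complex) \<Rightarrow> F3 mat \<Rightarrow> complex"
    by (rule vector_space_fun_scale)
  interpret group UT3 by (rule group_UT3)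
  have closed: "A * B \<in> carrier UT3" if "A \<in> carrier UT3" "B \<in> carrier UT3" for A B
    using m_closed[OF that] by simp
  have assoc: "A * B * C = A * (B * C)"
    if "A \<in> carrier UT3" "B \<in> carrier UT3" "C \<in> carrier UT3" for A B C
    using m_assoc[OF that] by simp
  have H: "h \<in> carrier UT3" if "h \<in> H_ut" for h
    using that subgroup.subset[OF subgroup_H_ut] by blast
  have "subspace (rho_ind_space k)"
    by (rule subspaceI) (auto simp: ind_space_def algebra_simps)
  moreover have "rho_ind g \<phi> \<in> rho_ind_space k"
    if "g \<in> carrier UT3" "\<phi> \<in> rho_ind_space k" for g \<phi>
    using that by (auto simp: ind_space_def ind_action_def closed assoc H)
  moreover have "rho_ind \<one>\<^bsub>UT3\<^esub> \<phi> = \<phi>" if "\<phi> \<in> rho_ind_space k" for \<phi>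
    using that r_one by (auto simp: ind_space_def ind_action_def fun_eq_iff)
  moreover have "rho_ind (g \<otimes>\<^bsub>UT3\<^esub> h) \<phi> = rho_ind g (rho_ind h \<phi>)"
    if "g \<in> carrier UT3" "h \<in> carrier UT3" for g h and \<phi> :: "F3 mat \<Rightarrow> complex"
    using that by (auto simp: ind_action_def closed assoc fun_eq_iff)
  moreover have "linear_map_on (rho_ind_space k) fun_scale fun_scale (rho_ind g)" for g
    by (simp add: linear_map_on_def ind_action_def fun_eq_iff)
  ultimately show ?thesis
    using group_UT3 vector_space_axioms by (simp add: Defs.representation_def Pi_iff)
qed

section \<open>Basis, dimension and irreducibility of the induced representations\<close>

lemma rho_ind_inj:
  "inj_on (\<lambda>\<phi>. (\<phi> (ut 0 0 0), \<phi> (ut 1 0 0), \<phi> (ut 2 0 0))) (rho_ind_space k)"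
proof (rule inj_onI)
  fix \<phi> \<psi> assume mem: "\<phi> \<in> rho_ind_space k" "\<psi> \<in> rho_ind_space k"
    and eq: "(\<phi> (ut 0 0 0), \<phi> (ut 1 0 0), \<phi> (ut 2 0 0)) = (\<psi> (ut 0 0 0), \<psi> (ut 1 0 0), \<psi> (ut 2 0 0))"
  show "\<phi> = \<psi>"
    using mem
  proof (rule rho_ind_space_eqI)
    show "\<phi> (ut n 0 0) = \<psi> (ut n 0 0)" for n
      using eq F3_cases[of n] by auto
  qed
qed

text \<open>The basis dual to evaluation at the coset representatives.\<close>

definition ind_basis :: "F3 \<Rightarrow> F3 \<Rightarrow> F3 mat \<Rightarrow> complex"
  where "ind_basis k n = ind_fun k (\<lambda>m. if m = n then 1 else 0)"

lemma ind_basis_ut: "ind_basis k n (ut m 0 0) = (if m = n then 1 else 0)"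
  by (simp add: ind_basis_def ind_fun_ut)

lemma rho_ind_dim: "vector_space.dim fun_scale (rho_ind_space k) = 3"
proof -
  interpret complex_representation fun_scale UT3 "rho_ind_space k" rho_ind
    using rho_ind_representation by (rule complex_representationI)
  have inj: "inj (ind_basis k)"
    using ind_basis_ut by (metis injI zero_neq_one)
  have mem: "ind_basis k n \<in> rho_ind_space k" for n
    unfolding ind_basis_def by (rule ind_fun_in_space)
  \<comment> \<open>Evaluation recovers the coefficients, which gives both spanning and
    independence.\<close>
  have coeff: "(\<Sum>n\<in>UNIV. fun_scale (c n) (ind_basis k n)) (ut m 0 0) = c m" for c m
    by (simp add: sum_fun_apply ind_basis_ut if_distrib[of "\<lambda>x. _ * x"] cong: if_cong)
  show ?thesis
  proof (rule dim_unique)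
    show "range (ind_basis k) \<subseteq> rho_ind_space k" using mem by blast
    show "rho_ind_space k \<subseteq> span (range (ind_basis k))"
    proof
      fix \<phi> assume \<phi>: "\<phi> \<in> rho_ind_space k"
      have "\<phi> = (\<Sum>n\<in>UNIV. fun_scale (\<phi> (ut n 0 0)) (ind_basis k n))"
        using \<phi> by (rule rho_ind_space_eqI)
          (simp_all only: coeff subspace_sum subspace_scale rep_subspace mem)
      also have "\<dots> \<in> span (range (ind_basis k))"
        by (intro span_sum span_scale span_base) simp
      finally show "\<phi> \<in> span (range (ind_basis k))" .
    qed
    show "independent (range (ind_basis k))"
    proof
      assume "dependent (range (ind_basis k))"
      then obtain c where c: "\<exists>\<phi>\<in>range (ind_basis k). c \<phi> \<noteq> 0"
          "(\<Sum>\<phi>\<in>range (ind_basis k). fun_scale (c \<phi>) \<phi>) = 0"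
        using dependent_finite[of "range (ind_basis k)"] by auto
      from c(2) have "(\<Sum>n\<in>UNIV. fun_scale (c (ind_basis k n)) (ind_basis k n)) = 0"
        by (simp only: sum.reindex[OF inj] o_def)
      then have "c (ind_basis k m) = 0" for m
        using coeff[of "\<lambda>n. c (ind_basis k n)" m] by simp
      then show False using c(1) by blast
    qed
    show "card (range (ind_basis k)) = 3"
      using card_image[OF inj] by simp
  qed
qed

text \<open>A nonzero invariant subspace contains an eigenvector of the \<open>g(0,0,c)\<close>; since these have
  three different eigenvalues on the basis, it is a multiple of a basis vector, and the \<open>g(a,0,0)\<close>
  permute the basis transitively.\<close>

lemma rho_ind_irreducible:
  assumes "k \<noteq> 0"
  shows "irreducible_rep UT3 fun_scale (rho_ind_space k) rho_ind"
proof -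
  interpret complex_representation fun_scale UT3 "rho_ind_space k" rho_ind
    using rho_ind_representation by (rule complex_representationI)
  show ?thesis
    using rho_ind_representation
  proof (rule irreducible_repI)
    show "rho_ind_space k \<noteq> {0}"
      using ind_fun_in_space[of k "\<lambda>_. 1"] ind_fun_ut[of k "\<lambda>_. 1" 0 0 0] by force
    fix W assume W: "W \<subseteq> rho_ind_space k" "subspace W" "W \<noteq> {0}"
      and "\<And>g w. g \<in> carrier UT3 \<Longrightarrow> w \<in> W \<Longrightarrow> rho_ind g w \<in> W"
    then have inv: "rho_ind (ut a b c) w \<in> W" if "w \<in> W" for a b c w
      using that by simp
    obtain j w where w: "w \<in> W" "w \<noteq> 0" "\<And>x. rho_ind (ut 0 0 x) w = fun_scale (omega_pow (j * x)) w"
      by (rule exists_eigenvector[of "\<lambda>x. ut 0 0 x" W])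
        (use W inv in \<open>simp_all add: one_UT3 ut_mult\<close>)
    have w_ind: "w \<in> rho_ind_space k" using w(1) W(1) by blast
    obtain n where n: "w (ut n 0 0) \<noteq> 0"
      using rho_ind_space_eqI[OF w_ind, of 0] w(2) subspace_0[OF rep_subspace] by auto
    \<comment> \<open>Wherever \<open>w\<close> is nonzero at \<open>ut l 0 0\<close>, comparing
      eigenvalues forces \<open>j = k * l\<close>, and \<open>k\<close> is invertible.\<close>
    have support: "w (ut m 0 0) = 0" if "m \<noteq> n" for m
    proof (rule ccontr)
      assume m: "w (ut m 0 0) \<noteq> 0"
      have "omega_pow j = omega_pow (k * l)" if "w (ut l 0 0) \<noteq> 0" for l
      proof -
        have "fun_scale (omega_pow (j * 1)) w (ut l 0 0) = omega_pow (k * (0 + l * 1)) * w (ut (0 + l) 0 0)"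
          by (simp only: rho_ind_ut[OF w_ind] flip: w(3))
        with that show ?thesis by simp
      qed
      from this[OF m] this[OF n] have "k * m = k * n"
        by (metis omega_pow_eq_iff)
      then have "(k * k) * m = (k * k) * n" by (simp only: mult.assoc)
      then show False using F3_inverse[OF assms] \<open>m \<noteq> n\<close> by simp
    qed
    have "rho_ind_space k \<subseteq> W"
    proof
      fix \<psi> assume \<psi>: "\<psi> \<in> rho_ind_space k"
      \<comment> \<open>Translation by \<open>ut (n - m) 0 0\<close> moves the support of
        \<open>w\<close> from index \<open>n\<close> to index \<open>m\<close>; the division
        normalizes the value there.\<close>
      let ?S = "\<Sum>m\<in>UNIV. fun_scale (\<psi> (ut m 0 0) / w (ut n 0 0)) (rho_ind (ut (n - m) 0 0) w)"
      have "?S \<in> W" by (intro subspace_sum subspace_scale W(2) inv w(1))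
      moreover have "\<psi> = ?S"
        using \<psi>
      proof (rule rho_ind_space_eqI)
        show "?S \<in> rho_ind_space k" using \<open>?S \<in> W\<close> W(1) by blast
        fix l
        have "w (ut (n - m + l) 0 0) = (if m = l then w (ut n 0 0) else 0)" for m
          using support[of "n - m + l"] by auto
        then show "\<psi> (ut l 0 0) = ?S (ut l 0 0)"
          using n by (simp add: sum_fun_apply rho_ind_ut[OF w_ind] if_distrib[of "\<lambda>x. _ * x"] cong: if_cong)
      qed
      ultimately show "\<psi> \<in> W" by simp
    qed
    with W(1) show "W = rho_ind_space k" by blast
  qed
qed

section \<open>The linear characters\<close>

text \<open>The scalar of \<open>rho_lin\<close>, detached from its space so that the same character
  can act on other lines.\<close>

definition chi :: "F3 \<Rightarrow> F3 \<Rightarrow> F3 mat \<Rightarrow> complex"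
  where "chi r s A = omega_pow (r * A $$ (0, 1) + s * A $$ (1, 2))"

lemma chi_ut: "chi r s (ut a b c) = omega_pow (r * a + s * c)"
  unfolding chi_def ut_entries ..

lemma chi_one: "chi r s \<one>\<^bsub>UT3\<^esub> = 1"
  by (simp add: one_UT3 chi_ut)

text \<open>The two entries above the diagonal are additive under multiplication; the mixed term
  only enters the corner.\<close>

lemma chi_mult:
  assumes "A \<in> carrier UT3" "B \<in> carrier UT3"
  shows "chi r s (A \<otimes>\<^bsub>UT3\<^esub> B) = chi r s A * chi r s B"
proof -
  obtain a b c a' b' c' where "A = ut a b c" "B = ut a' b' c'"
    using assms by (meson ut_cases)
  then show ?thesis
    by (simp add: ut_mult chi_ut algebra_simps flip: omega_pow_add)
qed

lemma rho_lin_eq: "rho_lin r s = (\<lambda>A. (*) (chi r s A))"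
  by (simp add: fun_eq_iff rho_lin_def chi_def)

lemma rho_lin_ut: "rho_lin r s (ut a b c) z = omega_pow (r * a + s * c) * z"
  by (simp only: rho_lin_eq chi_ut)

lemma rho_lin_irreducible: "irreducible_rep UT3 (*) UNIV (rho_lin r s)"
proof -
  have "range (\<lambda>z. z * (1 :: complex)) = UNIV" by simp
  then show ?thesis
    using irreducible_rep_character[OF group_UT3 vector_space_complex one_neq_zero chi_one[of r s] chi_mult]
    unfolding rho_lin_eq by simp
qed

text \<open>The map \<open>z \<mapsto> scl z v\<close> is a nonzero intertwiner, so Schur's lemma
  applies.\<close>

lemma rep_iso_rho_lin:
  assumes V: "irreducible_rep UT3 scl V \<rho>" and v: "v \<in> V" "v \<noteq> 0"
    and eig: "\<And>A. A \<in> carrier UT3 \<Longrightarrow> \<rho> A v = scl (chi r s A) v"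
  shows "rep_iso UT3 (*) UNIV (rho_lin r s) scl V \<rho>"
proof -
  interpret complex_representation scl UT3 V \<rho>
    using V by (intro complex_representationI irreducible_repD)
  show ?thesis
  proof (rule rep_isoI_Schur[OF rho_lin_irreducible V, where f = "\<lambda>z. scl z v" and v = 1])
    show "(\<lambda>z. scl z v) \<in> UNIV \<rightarrow> V" using v(1) subspace_scale[OF rep_subspace] by blast
    show "linear_map_on UNIV (*) scl (\<lambda>z. scl z v)"
      unfolding linear_map_on_def by (simp add: scale_left_distrib)
    show "scl (rho_lin r s g z) v = \<rho> g (scl z v)" if "g \<in> carrier UT3" for g z
      using that v(1) by (simp add: rho_lin_eq rep_scale eig mult.commute)
  qed (use v in simp_all)
qed

section \<open>Classification\<close>

text \<open>Frobenius reciprocity: a vector on which \<open>H\<close> acts by \<open>\<tau>\<^sub>k\<close> yields a homomorphism from the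
  induced representation, to which Schur's lemma applies.\<close>

lemma rep_iso_rho_ind:
  assumes V: "irreducible_rep UT3 scl V \<rho>" and v: "v \<in> V" "v \<noteq> 0" and k: "k \<noteq> 0"
    and eig: "\<And>b c. \<rho> (ut 0 b c) v = scl (omega_pow (k * b)) v"
  shows "rep_iso UT3 fun_scale (rho_ind_space k) rho_ind scl V \<rho>"
proof -
  interpret complex_representation scl UT3 V \<rho>
    using V by (intro complex_representationI irreducible_repD)
  \<comment> \<open>Sum of \<open>\<phi> x\<close> times the inverse of \<open>x\<close> applied to
    \<open>v\<close>, over coset representatives \<open>x\<close>. The inverse makes each term
    independent of the representative: the factors \<open>tau k h\<close> and its reciprocal
    cancel.\<close>
  define F where "F \<phi> = (\<Sum>n\<in>UNIV. scl (\<phi> (ut n 0 0)) (\<rho> (ut (- n) 0 0) v))" for \<phi>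
  have act: "\<rho> (ut a b c) (\<rho> (ut (- m) 0 0) v)
      = scl (omega_pow (k * (b + (m - a) * c))) (\<rho> (ut (a - m) 0 0) v)" for a b c m
  proof -
    \<comment> \<open>The factor from \<open>H\<close> is moved to the right, where it meets the
      eigenvector \<open>v\<close>; its corner entry compensates the commutator.\<close>
    have "ut a b c \<otimes>\<^bsub>UT3\<^esub> ut (- m) 0 0 = ut (a - m) 0 0 \<otimes>\<^bsub>UT3\<^esub> ut 0 (b + (m - a) * c) c"
      by (simp add: ut_mult algebra_simps)
    then show ?thesis
      using v(1) by (metis rep_mult ut_in_carrier eig rep_scale)
  qed
  show ?thesis
  proof (rule rep_isoI_Schur[OF rho_ind_irreducible[OF k] V, where f = F and v = "ind_basis k 0"])
    show "F \<in> rho_ind_space k \<rightarrow> V"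
      unfolding F_def
      by (intro Pi_I subspace_sum[OF rep_subspace] subspace_scale[OF rep_subspace] rep_closed v(1) ut_in_carrier)
    show "linear_map_on (rho_ind_space k) fun_scale scl F"
      unfolding linear_map_on_def F_def
      by (simp add: scale_left_distrib sum.distrib scale_sum_right)
    show "F (rho_ind g \<phi>) = \<rho> g (F \<phi>)" if g_in: "g \<in> carrier UT3" and \<phi>: "\<phi> \<in> rho_ind_space k" for g \<phi>
    proof -
      obtain a b c where g: "g = ut a b c" using g_in by (rule ut_cases)
      have "\<rho> g (F \<phi>) = (\<Sum>m\<in>UNIV. scl (\<phi> (ut m 0 0)) (\<rho> g (\<rho> (ut (- m) 0 0) v)))"
        unfolding F_def
        by (subst rep_sum)
          (simp_all add: g rep_scale rep_closed subspace_scale[OF rep_subspace] v(1))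
      also have "\<dots> = (\<Sum>m\<in>UNIV. scl (\<phi> (ut m 0 0) * omega_pow (k * (b + (m - a) * c)))
          (\<rho> (ut (a - m) 0 0) v))"
        by (simp add: g act)
      \<comment> \<open>The substitution \<open>m = a + n\<close> produces the shifted argument of
        \<open>rho_ind_ut\<close>.\<close>
      also have "\<dots> = (\<Sum>n\<in>UNIV. scl (\<phi> (ut (a + n) 0 0) * omega_pow (k * (b + (a + n - a) * c)))
          (\<rho> (ut (a - (a + n)) 0 0) v))"
        by (rule sum.reindex_bij_betw[symmetric]) (rule bij_plus)
      also have "\<dots> = F (rho_ind g \<phi>)"
        unfolding F_def g rho_ind_ut[OF \<phi>] by (simp add: mult.commute)
      finally show ?thesis ..
    qed
    show "ind_basis k 0 \<in> rho_ind_space k"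
      unfolding ind_basis_def by (rule ind_fun_in_space)
    have "F (ind_basis k 0) = \<rho> (ut 0 0 0) v"
      unfolding F_def by (simp add: ind_basis_ut sum_F3)
    then show "F (ind_basis k 0) \<noteq> 0"
      using v rep_one by (simp add: one_UT3)
  qed
qed

lemma irreducible_rep_UT3_cases:
  assumes V: "irreducible_rep UT3 scl V \<rho>"
  shows "(\<exists>r s. rep_iso UT3 scl V \<rho> (*) UNIV (rho_lin r s)) \<or>
    (\<exists>k\<in>{1, 2}. rep_iso UT3 scl V \<rho> fun_scale (rho_ind_space k) rho_ind)"
proof -
  interpret complex_representation scl UT3 V \<rho>
    using V by (intro complex_representationI irreducible_repD)
  have mult: "\<rho> (ut a b c) (\<rho> (ut a' b' c') v) = \<rho> (ut (a + a') (b + b' + a * c') (c + c')) v"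
    if "v \<in> V" for a b c a' b' c' v
    using rep_mult[OF ut_in_carrier ut_in_carrier that] by (simp add: ut_mult)
  note V_closed = subspace_add[OF rep_subspace] subspace_scale[OF rep_subspace]
    subspace_0[OF rep_subspace] rep_closed
  have V_nz: "V \<noteq> {0}" using V unfolding irreducible_rep_def by simp
  obtain k u where u: "u \<in> V" "u \<noteq> 0" "\<And>b. \<rho> (ut 0 b 0) u = scl (omega_pow (k * b)) u"
    by (rule exists_eigenvector[of "\<lambda>x. ut 0 x 0" V])
      (simp_all add: one_UT3 ut_mult rep_subspace rep_closed V_nz)
  \<comment> \<open>An eigenspace of the center, hence invariant under the whole group.\<close>
  let ?Z = "{v \<in> V. \<forall>b. \<rho> (ut 0 b 0) v = scl (omega_pow (k * b)) v}"
  have Z: "subspace ?Z"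
    by (rule subspaceI) (auto simp: V_closed rep_add rep_scale rep_zero scale_right_distrib mult.commute)
  have Z_inv: "\<rho> (ut a b c) v \<in> ?Z" if "v \<in> ?Z" for a b c v
  proof -
    have v_V: "v \<in> V" using that by blast
    have "\<rho> (ut 0 b' 0) (\<rho> (ut a b c) v) = \<rho> (ut a b c) (\<rho> (ut 0 b' 0) v)" for b'
      by (simp add: mult[OF v_V] add.commute)
    then show ?thesis using that by (simp add: rep_scale V_closed)
  qed
  have "u \<in> ?Z" using u by simp
  with u(2) have Z_nz: "?Z \<noteq> {0}" by blast
  \<comment> \<open>Searching inside \<open>?Z\<close> keeps the central eigenvalue, so
    \<open>w\<close> is an eigenvector of all of \<open>H\<close>.\<close>
  obtain s w where w: "w \<in> ?Z" "w \<noteq> 0" "\<And>c. \<rho> (ut 0 0 c) w = scl (omega_pow (s * c)) w"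
  proof (rule exists_eigenvector[of "\<lambda>x. ut 0 0 x" ?Z])
    show "\<rho> (ut 0 0 x) w \<in> ?Z" if "w \<in> ?Z" for x w using that by (rule Z_inv)
    show "?Z \<noteq> {0}" by (rule Z_nz)
  qed (auto simp: one_UT3 ut_mult Z)
  have w_V: "w \<in> V" using w(1) by blast
  have w_H: "\<rho> (ut 0 b c) w = scl (omega_pow (k * b + s * c)) w" for b c
    using mult[OF w_V, of 0 b 0 0 0 c] w(1,3) w_V
    by (simp add: rep_scale omega_pow_add mult.commute)
  show ?thesis
  proof (cases "k = 0")
    case True
    let ?E = "{v \<in> V. \<forall>b c. \<rho> (ut 0 b c) v = scl (omega_pow (s * c)) v}"
    have E: "subspace ?E"
      by (rule subspaceI) (auto simp: V_closed rep_add rep_scale rep_zero scale_right_distrib mult.commute)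
    have E_inv: "\<rho> (ut a 0 0) v \<in> ?E" if "v \<in> ?E" for a v
    proof -
      have v_V: "v \<in> V" using that by blast
      \<comment> \<open>Conjugation by \<open>ut a 0 0\<close> alters only the corner entry, which
        the eigenvalue defining \<open>?E\<close> ignores.\<close>
      have "\<rho> (ut 0 b c) (\<rho> (ut a 0 0) v) = \<rho> (ut a 0 0) (\<rho> (ut 0 (b - a * c) c) v)" for b c
        by (simp add: mult[OF v_V])
      then show ?thesis using that by (simp add: rep_scale V_closed)
    qed
    have "w \<in> ?E" using w_V w_H True by simp
    with w(2) have E_nz: "?E \<noteq> {0}" by blast
    obtain r v where v: "v \<in> ?E" "v \<noteq> 0" "\<And>a. \<rho> (ut a 0 0) v = scl (omega_pow (r * a)) v"
    proof (rule exists_eigenvector[of "\<lambda>x. ut x 0 0" ?E])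
      show "\<rho> (ut x 0 0) w \<in> ?E" if "w \<in> ?E" for x w using that by (rule E_inv)
      show "?E \<noteq> {0}" by (rule E_nz)
    qed (auto simp: one_UT3 ut_mult E)
    have v_V: "v \<in> V" using v(1) by blast
    have "\<rho> (ut a b c) v = scl (chi r s (ut a b c)) v" for a b c
      using mult[OF v_V, of 0 b c a 0 0] v(1,3) v_V
      by (simp add: rep_scale chi_ut omega_pow_add)
    then have "\<rho> A v = scl (chi r s A) v" if "A \<in> carrier UT3" for A
      using that by (auto elim: ut_cases)
    then have "rep_iso UT3 (*) UNIV (rho_lin r s) scl V \<rho>"
      using rep_iso_rho_lin[OF V v_V v(2)] by blast
    then show ?thesis
      using rep_iso_sym irreducible_repD[OF rho_lin_irreducible] by blast
  next
    case False
    text \<open>Conjugation by \<open>g(x,0,0)\<close> multiplies the eigenvalue of \<open>g(0,0,1)\<close> by \<open>\<omega>\<^sup>-\<^sup>k\<^sup>x\<close>, so it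
      can be made trivial.\<close>
    let ?x = "k * s"
    define v where "v = \<rho> (ut ?x 0 0) w"
    \<comment> \<open>A nonzero \<open>k\<close> is its own inverse modulo 3, which is why
      \<open>?x\<close> solves \<open>k * x = s\<close>.\<close>
    have kx: "k * ?x = s"
      using F3_inverse[OF False] by (simp flip: mult.assoc)
    have v_V: "v \<in> V" unfolding v_def using w_V by (simp add: rep_closed)
    have "\<rho> (ut (- ?x) 0 0) v = w"
      unfolding v_def using rep_one[OF w_V] by (simp add: mult w_V one_UT3)
    then have "v \<noteq> 0" using w(2) by (metis rep_zero ut_in_carrier)
    moreover have "\<rho> (ut 0 b c) v = scl (omega_pow (k * b)) v" for b c
    proof -
      have "\<rho> (ut 0 b c) v = \<rho> (ut ?x 0 0) (\<rho> (ut 0 (b - ?x * c) c) w)"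
        unfolding v_def by (simp add: mult w_V)
      also have "\<dots> = scl (omega_pow (k * (b - ?x * c) + s * c)) v"
        unfolding v_def w_H by (simp add: rep_scale w_V)
      also have "k * (b - ?x * c) + s * c = k * b + (s - k * ?x) * c"
        by (simp add: algebra_simps)
      finally show ?thesis by (simp only: kx diff_self mult_zero_left add_0_right)
    qed
    ultimately have "rep_iso UT3 fun_scale (rho_ind_space k) rho_ind scl V \<rho>"
      using rep_iso_rho_ind[OF V v_V _ False] by blast
    moreover have "k \<in> {1, 2}" using False F3_cases[of k] by blast
    ultimately show ?thesis
      using rep_iso_sym rho_ind_representation by blast
  qed
qed

section \<open>Pairwise non-isomorphism\<close>

lemma rho_lin_not_iso:
  assumes "rep_iso UT3 (*) UNIV (rho_lin r s) (*) UNIV (rho_lin r' s')"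
  shows "(r, s) = (r', s')"
proof -
  have "chi r s A = chi r' s' A" if "A \<in> carrier UT3" for A
    using rep_iso_scalar_eq[OF rho_lin_irreducible rho_lin_irreducible assms that]
    unfolding rho_lin_eq by blast
  then have "omega_pow (r * a + s * c) = omega_pow (r' * a + s' * c)" for a c
    by (metis chi_ut ut_in_carrier)
  \<comment> \<open>The elements with \<open>(a, c)\<close> equal to \<open>(1, 0)\<close> and
    \<open>(0, 1)\<close> detect \<open>r\<close> and \<open>s\<close>.\<close>
  from this[of 1 0] this[of 0 1] show ?thesis by (simp add: omega_pow_eq_iff)
qed

text \<open>The central character distinguishes the two induced representations from each other and
  from the linear ones, where the center acts trivially.\<close>

lemma rho_ind_center:
  assumes "\<phi> \<in> rho_ind_space k"
  shows "rho_ind (ut 0 1 0) \<phi> = fun_scale (omega_pow k) \<phi>"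
proof -
  interpret complex_representation fun_scale UT3 "rho_ind_space k" rho_ind
    using rho_ind_representation by (rule complex_representationI)
  show ?thesis
    by (rule rho_ind_space_eqI[where k = k])
      (simp_all add: assms rep_closed subspace_scale[OF rep_subspace] rho_ind_ut[OF assms])
qed

lemma rho_ind_not_iso:
  assumes "k \<noteq> 0" "k' \<noteq> 0"
    and "rep_iso UT3 fun_scale (rho_ind_space k) rho_ind fun_scale (rho_ind_space k') rho_ind"
  shows "k = k'"
  using rep_iso_scalar_eq[OF rho_ind_irreducible[OF assms(1)] rho_ind_irreducible[OF assms(2)] assms(3)
      ut_in_carrier rho_ind_center rho_ind_center]
  by (simp add: omega_pow_eq_iff)

lemma rho_lin_rho_ind_not_iso:
  assumes k: "k \<noteq> 0"
  shows "\<not> rep_iso UT3 (*) UNIV (rho_lin r s) fun_scale (rho_ind_space k) rho_ind"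
proof
  assume iso: "rep_iso UT3 (*) UNIV (rho_lin r s) fun_scale (rho_ind_space k) rho_ind"
  have "1 = omega_pow k"
    by (rule rep_iso_scalar_eq[OF rho_lin_irreducible rho_ind_irreducible[OF k] iso ut_in_carrier _ rho_ind_center])
      (simp_all add: rho_lin_eq chi_ut)
  then show False using k omega_pow_eq_1_iff by metis
qed

text \<open>\<open>irrep_classes\<close> needs all representations in one ambient space, so the linear characters are
  moved to the line of constant functions.\<close>

definition lin_line :: "(F3 mat \<Rightarrow> complex) set"
  where "lin_line = range (\<lambda>z. fun_scale z (\<lambda>_. 1))"

definition lin_action :: "F3 \<Rightarrow> F3 \<Rightarrow> F3 mat \<Rightarrow> (F3 mat \<Rightarrow> complex) \<Rightarrow> F3 mat \<Rightarrow> complex"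
  where "lin_action r s A = fun_scale (chi r s A)"

lemma lin_line_irreducible: "irreducible_rep UT3 fun_scale lin_line (lin_action r s)"
proof -
  have "(\<lambda>_. 1) \<noteq> (0 :: F3 mat \<Rightarrow> complex)" by (simp add: fun_eq_iff)
  from irreducible_rep_character[OF group_UT3 vector_space_fun_scale this chi_one[of r s] chi_mult]
  show ?thesis unfolding lin_line_def lin_action_def[abs_def] .
qed

lemma rho_lin_iso_lin_line: "rep_iso UT3 (*) UNIV (rho_lin r s) fun_scale lin_line (lin_action r s)"
proof (rule rep_iso_rho_lin[OF lin_line_irreducible])
  show "(\<lambda>_. 1) \<in> lin_line"
    unfolding lin_line_def by (rule range_eqI[of _ _ 1]) (simp add: fun_eq_iff)
qed (simp_all add: fun_eq_iff lin_action_def)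

section \<open>Counting the isomorphism classes\<close>

lemma card_irrep_classes_UT3:
  "card (irrep_classes UT3 (fun_scale :: complex \<Rightarrow> (F3 mat \<Rightarrow> complex) \<Rightarrow> F3 mat \<Rightarrow> complex)) = 11"
proof -
  let ?scl = "fun_scale :: complex \<Rightarrow> (F3 mat \<Rightarrow> complex) \<Rightarrow> F3 mat \<Rightarrow> complex"
  let ?A = "{(V, \<rho>). irreducible_rep UT3 ?scl V \<rho>}"
  let ?R = "{((V, \<rho>), (W, \<sigma>)). irreducible_rep UT3 ?scl V \<rho> \<and> irreducible_rep UT3 ?scl W \<sigma> \<and>
                        rep_iso UT3 ?scl V \<rho> ?scl W \<sigma>}"
  \<comment> \<open>Nine pairs \<open>(r, s)\<close> and two nonzero values of
    \<open>k\<close>.\<close>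
  define I :: "(F3 \<times> F3 + F3) set" where "I = UNIV <+> {1, 2}"
  define f where "f = case_sum (\<lambda>(r, s). (lin_line, lin_action r s)) (\<lambda>k. (rho_ind_space k, rho_ind))"
  have f_simps: "f (Inl (r, s)) = (lin_line, lin_action r s)" "f (Inr k) = (rho_ind_space k, rho_ind)"
    for r s k by (simp_all add: f_def)
  have k_nz: "k \<noteq> 0" if "k \<in> {1, 2}" for k :: F3 using that by auto
  note lin_iso = rho_lin_iso_lin_line
  have lin_iso': "rep_iso UT3 fun_scale lin_line (lin_action r s) (*) UNIV (rho_lin r s)" for r s
    by (rule rep_iso_sym[OF irreducible_repD[OF rho_lin_irreducible] lin_iso])
  have "equiv ?A ?R"
  proof (rule equivI)
    show "?R \<subseteq> ?A \<times> ?A" by auto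
    show "refl_on ?A ?R" unfolding refl_on_def using rep_iso_refl by auto
    show "sym ?R" unfolding sym_def using rep_iso_sym irreducible_repD by blast
    show "trans ?R" unfolding trans_def using rep_iso_trans by blast
  qed
  moreover have "f i \<in> ?A" if "i \<in> I" for i
    using that lin_line_irreducible rho_ind_irreducible k_nz by (auto simp: I_def f_simps)
  moreover have "i = j" if ij: "i \<in> I" "j \<in> I" "(f i, f j) \<in> ?R" for i j
  proof (cases i; cases j)
    fix p q assume eq: "i = Inl p" "j = Inl q"
    obtain r s r' s' where p: "p = (r, s)" "q = (r', s')" by (meson surj_pair)
    have "rep_iso UT3 fun_scale lin_line (lin_action r s) fun_scale lin_line (lin_action r' s')"
      using ij(3) by (simp add: eq p f_simps)
    \<comment> \<open>Composing with the isomorphisms to the line of constants transfers the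
      question back to the complex numbers, where it is settled.\<close>
    then have "rep_iso UT3 (*) UNIV (rho_lin r s) (*) UNIV (rho_lin r' s')"
      by (rule rep_iso_trans[OF lin_iso rep_iso_trans[OF _ lin_iso']])
    then show ?thesis using rho_lin_not_iso eq p by simp
  next
    fix p k assume eq: "i = Inl p" "j = Inr k"
    obtain r s where p: "p = (r, s)" by (meson surj_pair)
    have "rep_iso UT3 fun_scale lin_line (lin_action r s) fun_scale (rho_ind_space k) rho_ind"
      using ij(3) by (simp add: eq p f_simps)
    then have "rep_iso UT3 (*) UNIV (rho_lin r s) fun_scale (rho_ind_space k) rho_ind"
      by (rule rep_iso_trans[OF lin_iso])
    then show ?thesis using rho_lin_rho_ind_not_iso ij(2) k_nz eq by (auto simp: I_def)
  next
    fix k p assume eq: "i = Inr k" "j = Inl p"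
    obtain r s where p: "p = (r, s)" by (meson surj_pair)
    have "rep_iso UT3 fun_scale (rho_ind_space k) rho_ind fun_scale lin_line (lin_action r s)"
      using ij(3) by (simp add: eq p f_simps)
    from rep_iso_trans[OF this lin_iso'] have "rep_iso UT3 (*) UNIV (rho_lin r s) fun_scale (rho_ind_space k) rho_ind"
      by (rule rep_iso_sym[OF rho_ind_representation])
    then show ?thesis using rho_lin_rho_ind_not_iso ij(1) k_nz eq by (auto simp: I_def)
  next
    fix k k' assume eq: "i = Inr k" "j = Inr k'"
    then have "k \<noteq> 0" "k' \<noteq> 0" using ij(1,2) k_nz unfolding I_def by blast+
    moreover have "rep_iso UT3 fun_scale (rho_ind_space k) rho_ind fun_scale (rho_ind_space k') rho_ind"
      using ij(3) by (simp add: eq f_simps)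
    ultimately show ?thesis using rho_ind_not_iso eq by simp
  qed
  moreover have "\<exists>i\<in>I. (a, f i) \<in> ?R" if "a \<in> ?A" for a
  proof -
    obtain V \<rho> where a: "a = (V, \<rho>)" by (meson surj_pair)
    then have V: "irreducible_rep UT3 fun_scale V \<rho>" using that by simp
    from irreducible_rep_UT3_cases[OF V] show ?thesis
    proof (elim disjE exE bexE)
      fix r s assume "rep_iso UT3 fun_scale V \<rho> (*) UNIV (rho_lin r s)"
      then have "rep_iso UT3 fun_scale V \<rho> fun_scale lin_line (lin_action r s)"
        by (rule rep_iso_trans[OF _ lin_iso])
      then have "(a, f (Inl (r, s))) \<in> ?R"
        using V lin_line_irreducible by (simp add: a f_simps)
      moreover have "Inl (r, s) \<in> I" unfolding I_def by (intro InlI UNIV_I)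
      ultimately show ?thesis by (intro bexI[of _ "Inl (r, s)"])
    next
      fix k :: F3 assume k: "k \<in> {1, 2}"
        and "rep_iso UT3 fun_scale V \<rho> fun_scale (rho_ind_space k) rho_ind"
      then have "(a, f (Inr k)) \<in> ?R"
        using V rho_ind_irreducible[OF k_nz[OF k]] by (simp add: a f_simps)
      moreover have "Inr k \<in> I" using k unfolding I_def by (rule InrI)
      ultimately show ?thesis by (intro bexI[of _ "Inr k"])
    qed
  qed
  ultimately have "card (?A // ?R) = card I"
    by (rule card_quotient_transversal)
  also have "card I = 11"
    unfolding I_def by (simp add: card_Plus card_cartesian_product flip: UNIV_Times_UNIV)
  finally show ?thesis unfolding irrep_classes_def .
qed

theorem mainTheorem4:
  fixes scl :: "complex \<Rightarrow> 'v::ab_group_add \<Rightarrow> 'v"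
    and V :: "'v set"
    and \<rho> :: "F3 mat \<Rightarrow> 'v \<Rightarrow> 'v"
  shows
    "group UT3 \<and> carrier UT3 = {ut a b c | a b c. True} \<and>
     vector_space.dim (*) (UNIV :: complex set) = 1 \<and>
     (\<forall>r s.
        irreducible_rep UT3 (*) UNIV (rho_lin r s) \<and>
        (\<forall>a b c z. rho_lin r s (ut a b c) z = omega_pow (r * a + s * c) * z)) \<and>
     subgroup H_ut UT3 \<and>
     (\<forall>k\<in>{1, 2}.
        tau k \<in> hom (UT3\<lparr>carrier := H_ut\<rparr>) C_star \<and>
        (\<forall>b c. tau k (ut 0 b c) = omega_pow (k * b)) \<and>
        irreducible_rep UT3 fun_scale (rho_ind_space k) rho_ind \<and>
        vector_space.dim fun_scale (rho_ind_space k) = 3 \<and>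
        inj_on (\<lambda>\<phi>. (\<phi> (ut 0 0 0), \<phi> (ut 1 0 0), \<phi> (ut 2 0 0))) (rho_ind_space k) \<and>
        (\<forall>a b c. \<forall>\<phi>\<in>rho_ind_space k. \<forall>n.
           rho_ind (ut a b c) \<phi> (ut n 0 0) = omega_pow (k * (b + n * c)) * \<phi> (ut (a + n) 0 0))) \<and>
     (\<forall>r s r' s'. (r, s) \<noteq> (r', s') \<longrightarrow>
        \<not> rep_iso UT3 (*) UNIV (rho_lin r s) (*) UNIV (rho_lin r' s')) \<and>
     (\<forall>k\<in>{1, 2}. \<forall>k'\<in>{1, 2}. k \<noteq> k' \<longrightarrow>
        \<not> rep_iso UT3 fun_scale (rho_ind_space k) rho_ind fun_scale (rho_ind_space k') rho_ind) \<and>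
     (\<forall>r s. \<forall>k\<in>{1, 2}.
        \<not> rep_iso UT3 (*) UNIV (rho_lin r s) fun_scale (rho_ind_space k) rho_ind) \<and>
     (irreducible_rep UT3 scl V \<rho> \<longrightarrow>
        (\<exists>r s. rep_iso UT3 scl V \<rho> (*) UNIV (rho_lin r s)) \<or>
        (\<exists>k\<in>{1, 2}. rep_iso UT3 scl V \<rho> fun_scale (rho_ind_space k) rho_ind)) \<and>
     card (irrep_classes UT3 (fun_scale :: complex \<Rightarrow> (F3 mat \<Rightarrow> complex) \<Rightarrow> F3 mat \<Rightarrow> complex)) = 11"
proof -
  interpret vector_space "(*) :: complex \<Rightarrow> complex \<Rightarrow> complex"
    by (rule vector_space_complex)
  \<comment> \<open>The vector 1 is a basis of the complex numbers over themselves.\<close>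
  have "range (\<lambda>z. z * (1 :: complex)) = UNIV" by simp
  then have "span {1 :: complex} = UNIV" by (simp only: span_singleton)
  moreover have "independent {1 :: complex}" by (simp add: dependent_single)
  ultimately have "dim (UNIV :: complex set) = 1"
    using dim_unique[of "{1}" UNIV 1] by simp
  moreover have "\<not> rep_iso UT3 fun_scale (rho_ind_space k) rho_ind fun_scale (rho_ind_space k') rho_ind"
    if "k \<in> {1, 2}" "k' \<in> {1, 2}" "k \<noteq> k'" for k k'
    using rho_ind_not_iso[of k k'] that by auto
  moreover have "\<not> rep_iso UT3 (*) UNIV (rho_lin r s) (*) UNIV (rho_lin r' s')"
    if "(r, s) \<noteq> (r', s')" for r s r' s'
    using rho_lin_not_iso that by blast
  moreover have "k \<noteq> 0" if "k \<in> {1, 2}" for k :: F3 using that by auto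
  ultimately show ?thesis
    by (intro conjI ballI allI impI group_UT3 carrier_UT3 subgroup_H_ut rho_lin_irreducible rho_lin_ut
        tau_hom tau_ut rho_ind_irreducible rho_ind_dim rho_ind_inj rho_ind_ut card_irrep_classes_UT3
        irreducible_rep_UT3_cases rho_lin_rho_ind_not_iso) blast+
qed

end
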